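(* Let $M$ be a smooth manifold, $f\in C^\infty(M)$ and $\theta$ a closed $1$-form on $M$. The cohomology $H^\bullet_{f,\theta}(M)$ depends only on the de Rham class of $\theta$: for every $\sigma\in C^\infty(M)$ there is an isomorphism $$H^{\bullet}_{f,\theta-d\sigma}(M)\cong H^{\bullet}_{f,\theta}(M).$$
   Context: $\Omega^r(M)$ is the space of smooth real $r$-forms on $M$. For $f\in C^\infty(M)$, a closed $1$-form $\theta$, and $\varphi\in\Omega^r(M)$, put $d_f\varphi=f\,d\varphi-r\,df\wedge\varphi$ and $d_{f,\theta}\varphi=d_f\varphi-f\theta\wedge\varphi$. Then $d_{f,\theta}^2=0$, and $H^\bullet_{f,\theta}(M)$ is the cohomology of the complex $(\Omega^\bullet(M),d_{f,\theta})$. *)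

theory Defs
  imports
    "HOL-Analysis.Analysis"
    "HOL-Library.Function_Algebras"
    "HOL-Algebra.AbelCoset"
    "HOL-Algebra.Module"
begin

section \<open>Smooth maps between normed spaces\<close>

text \<open>
  Used only for open \<open>S\<close> in a finite-dimensional space, where continuity of all iterated
  directional derivatives up to order \<open>k\<close> is the usual class \<open>C\<^sup>k\<close>.
\<close>

primrec Ck_on ::
  "nat \<Rightarrow> 'a::real_normed_vector set \<Rightarrow> ('a \<Rightarrow> 'b::real_normed_vector) \<Rightarrow> bool" where
  "Ck_on 0 S g \<longleftrightarrow> continuous_on S g"
| "Ck_on (Suc k) S g \<longleftrightarrow>
     (\<forall>x\<in>S. g differentiable (at x)) \<and> (\<forall>v. Ck_on k S (\<lambda>x. frechet_derivative g (at x) v))"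

definition smooth_on ::
  "'a::real_normed_vector set \<Rightarrow> ('a \<Rightarrow> 'b::real_normed_vector) \<Rightarrow> bool" where
  "smooth_on S g \<longleftrightarrow> (\<forall>k. Ck_on k S g)"


section \<open>Smooth manifolds\<close>

text \<open>
  A chart is a pair \<open>(U, \<kappa>)\<close>; the values of \<open>\<kappa>\<close> outside \<open>U\<close> are irrelevant.
\<close>

type_synonym ('m, 'e) chart = "'m set \<times> ('m \<Rightarrow> 'e)"

abbreviation chart_dom :: "('m, 'e) chart \<Rightarrow> 'm set" where
  "chart_dom \<equiv> fst"

abbreviation chart_map :: "('m, 'e) chart \<Rightarrow> 'm \<Rightarrow> 'e" where
  "chart_map \<equiv> snd"

definition chart_inv :: "('m, 'e) chart \<Rightarrow> 'e \<Rightarrow> 'm" where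
  "chart_inv c = inv_into (chart_dom c) (chart_map c)"

definition transition :: "('m, 'e) chart \<Rightarrow> ('m, 'e) chart \<Rightarrow> 'e \<Rightarrow> 'e" where
  "transition c c' = chart_map c' \<circ> chart_inv c"

definition is_chart :: "'m topology \<Rightarrow> ('m, 'e::real_normed_vector) chart \<Rightarrow> bool" where
  "is_chart X c \<longleftrightarrow>
     openin X (chart_dom c) \<and> open (chart_map c ` chart_dom c) \<and>
     homeomorphic_map (subtopology X (chart_dom c)) (top_of_set (chart_map c ` chart_dom c))
       (chart_map c)"

text \<open>
  The model space \<open>'e\<close> is a normed space of arbitrary finite dimension rather than a
  \<open>euclidean_space\<close>, because the latter class excludes dimension 0.  The smooth structure is
  the one determined by the atlas \<open>A\<close>, which may but need not be maximal.
\<close>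

locale smooth_manifold =
  fixes X :: "'m topology" and A :: "('m, 'e::real_normed_vector) chart set"
  assumes finite_dim: "\<exists>B::'e set. finite B \<and> span B = UNIV"
    and Hausdorff: "Hausdorff_space X"
    and second_countable: "second_countable X"
    and charts: "\<And>c. c \<in> A \<Longrightarrow> is_chart X c"
    and covering: "(\<Union>c\<in>A. chart_dom c) = topspace X"
    and compatible: "\<And>c c'. c \<in> A \<Longrightarrow> c' \<in> A \<Longrightarrow>
      smooth_on (chart_map c ` (chart_dom c \<inter> chart_dom c')) (transition c c')"

definition smooth_funs :: "('m, 'e::real_normed_vector) chart set \<Rightarrow> ('m \<Rightarrow> real) set" where
  "smooth_funs A = {g. \<forall>c\<in>A. smooth_on (chart_map c ` chart_dom c) (g \<circ> chart_inv c)}"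


section \<open>Differential forms\<close>

text \<open>
  A tangent vector at \<open>p\<close> is given by its components \<open>v :: 'e\<close> in a chart \<open>c\<close> around \<open>p\<close>; its
  components in another chart \<open>c'\<close> are the image of \<open>v\<close> under the derivative of the transition map.
  For a form \<open>\<phi>\<close>, the number \<open>\<phi> c p [v\<^sub>1, \<dots>, v\<^sub>r]\<close> is the value of \<open>\<phi>\<close> at \<open>p\<close> on the tangent
  vectors with components \<open>v\<^sub>1, \<dots>, v\<^sub>r\<close> in \<open>c\<close>.  Forms vanish on all meaningless arguments
  (\<open>c\<close> not in the atlas, \<open>p\<close> not in the domain of \<open>c\<close>, wrong number of vectors), so that equality
  of forms is equality of functions.
\<close>

type_synonym ('m, 'e) form = "('m, 'e) chart \<Rightarrow> 'm \<Rightarrow> 'e list \<Rightarrow> real"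

definition forms :: "('m, 'e::real_normed_vector) chart set \<Rightarrow> nat \<Rightarrow> ('m, 'e) form set" where
  "forms A r = {\<phi>.
     (\<forall>c p vs. c \<notin> A \<or> p \<notin> chart_dom c \<or> length vs \<noteq> r \<longrightarrow> \<phi> c p vs = 0) \<and>
     (\<forall>c\<in>A. \<forall>p\<in>chart_dom c. \<forall>vs. length vs = r \<longrightarrow>
        (\<forall>i<r. linear (\<lambda>v. \<phi> c p (vs[i := v]))) \<and>
        (\<not> distinct vs \<longrightarrow> \<phi> c p vs = 0)) \<and>
     (\<forall>c\<in>A. \<forall>c'\<in>A. \<forall>p\<in>chart_dom c \<inter> chart_dom c'. \<forall>vs. length vs = r \<longrightarrow>
        \<phi> c p vs =
        \<phi> c' p (map (frechet_derivative (transition c c') (at (chart_map c p))) vs)) \<and>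
     (\<forall>c\<in>A. \<forall>vs. length vs = r \<longrightarrow>
        smooth_on (chart_map c ` chart_dom c) (\<lambda>x. \<phi> c (chart_inv c x) vs))}"

definition fun_form :: "('m, 'e) chart set \<Rightarrow> ('m \<Rightarrow> real) \<Rightarrow> ('m, 'e) form" where
  "fun_form A g = (\<lambda>c p vs. if c \<in> A \<and> p \<in> chart_dom c \<and> vs = [] then g p else 0)"

definition fmult :: "('m \<Rightarrow> real) \<Rightarrow> ('m, 'e) form \<Rightarrow> ('m, 'e) form" where
  "fmult g \<phi> = (\<lambda>c p vs. g p * \<phi> c p vs)"

text \<open>
  The wedge product as a sum over shuffles (determinant convention, no factorials).  A shuffle is
  given by the set \<open>S\<close> of positions of the arguments passed to \<open>\<alpha>\<close>, and its sign by the number of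
  inversions.  Summing over all \<open>S\<close> is harmless, as forms vanish on lists of the wrong length.
  If \<open>\<alpha>\<close> is a 1-form, only the singletons \<open>S = {i}\<close> contribute, with sign \<open>(-1) ^ i\<close>.
\<close>

definition wedge :: "('m, 'e) form \<Rightarrow> ('m, 'e) form \<Rightarrow> ('m, 'e) form" (infixr \<open>\<and>\<^sub>F\<close> 70) where
  "\<alpha> \<and>\<^sub>F \<beta> = (\<lambda>c p vs. \<Sum>S\<in>Pow {..<length vs}.
     (- 1) ^ card {(i, j). i \<in> S \<and> j \<in> {..<length vs} - S \<and> j < i} *
     \<alpha> c p (nths vs S) * \<beta> c p (nths vs (- S)))"

text \<open>
  The exterior derivative, computed in each chart by
  \<open>d\<phi> (v\<^sub>0, \<dots>, v\<^sub>r) = \<Sum>i\<le>r. (-1) ^ i \<partial>\<^bsub>v\<^sub>i\<^esub> (\<phi> (v\<^sub>0, \<dots>, v\<^sub>i omitted, \<dots>, v\<^sub>r))\<close>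
  for constant vectors \<open>v\<^sub>i\<close>; on functions this is the differential.
\<close>

definition ext_deriv :: "('m, 'e::real_normed_vector) form \<Rightarrow> ('m, 'e) form" where
  "ext_deriv \<phi> = (\<lambda>c p vs. if p \<in> chart_dom c
     then \<Sum>i<length vs. (- 1) ^ i *
       frechet_derivative (\<lambda>x. \<phi> c (chart_inv c x) (nths vs (- {i}))) (at (chart_map c p)) (vs ! i)
     else 0)"

abbreviation differential ::
  "('m, 'e::real_normed_vector) chart set \<Rightarrow> ('m \<Rightarrow> real) \<Rightarrow> ('m, 'e) form" where
  "differential A g \<equiv> ext_deriv (fun_form A g)"

definition closed_one_form ::
  "('m, 'e::real_normed_vector) chart set \<Rightarrow> ('m, 'e) form \<Rightarrow> bool" where
  "closed_one_form A \<theta> \<longleftrightarrow> \<theta> \<in> forms A 1 \<and> ext_deriv \<theta> = 0"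


section \<open>The cohomology of the twisted differential\<close>

definition d_f :: "('m, 'e::real_normed_vector) chart set \<Rightarrow> ('m \<Rightarrow> real) \<Rightarrow> nat \<Rightarrow>
    ('m, 'e) form \<Rightarrow> ('m, 'e) form" where
  "d_f A f r \<phi> = fmult f (ext_deriv \<phi>) - fmult (\<lambda>_. real r) (differential A f \<and>\<^sub>F \<phi>)"

definition d_f_theta :: "('m, 'e::real_normed_vector) chart set \<Rightarrow> ('m \<Rightarrow> real) \<Rightarrow>
    ('m, 'e) form \<Rightarrow> nat \<Rightarrow> ('m, 'e) form \<Rightarrow> ('m, 'e) form" where
  "d_f_theta A f \<theta> r \<phi> = d_f A f r \<phi> - fmult f \<theta> \<and>\<^sub>F \<phi>"

definition cocycles :: "('m, 'e::real_normed_vector) chart set \<Rightarrow> ('m \<Rightarrow> real) \<Rightarrow>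
    ('m, 'e) form \<Rightarrow> nat \<Rightarrow> ('m, 'e) form set" where
  "cocycles A f \<theta> r = {\<phi> \<in> forms A r. d_f_theta A f \<theta> r \<phi> = 0}"

fun coboundaries :: "('m, 'e::real_normed_vector) chart set \<Rightarrow> ('m \<Rightarrow> real) \<Rightarrow>
    ('m, 'e) form \<Rightarrow> nat \<Rightarrow> ('m, 'e) form set" where
  "coboundaries A f \<theta> 0 = {0}"
| "coboundaries A f \<theta> (Suc r) = d_f_theta A f \<theta> r ` forms A r"

text \<open>
  Real vector spaces are \<open>module\<close> records over the reals; the ring multiplication and unit that
  these records inherit play no role for modules.
\<close>

definition form_space :: "('m, 'e) form set \<Rightarrow> (real, ('m, 'e) form) module" where
  "form_space V = \<lparr>carrier = V, mult = undefined, one = undefined, zero = 0, add = (+),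
     smult = (\<lambda>t. fmult (\<lambda>_. t))\<rparr>"

definition quotient_space :: "(real, 'v) module \<Rightarrow> 'v set \<Rightarrow> (real, 'v set) module" where
  "quotient_space V W = \<lparr>carrier = a_rcosets\<^bsub>V\<^esub> W, mult = undefined, one = undefined,
     zero = W, add = set_add V,
     smult = (\<lambda>t K. \<Union>x\<in>K. W +>\<^bsub>V\<^esub> (t \<odot>\<^bsub>V\<^esub> x))\<rparr>"

definition cohomology :: "('m, 'e::real_normed_vector) chart set \<Rightarrow> ('m \<Rightarrow> real) \<Rightarrow>
    ('m, 'e) form \<Rightarrow> nat \<Rightarrow> (real, ('m, 'e) form set) module" where
  "cohomology A f \<theta> r =
     quotient_space (form_space (cocycles A f \<theta> r)) (coboundaries A f \<theta> r)"

definition linearly_isomorphic :: "(real, 'v) module \<Rightarrow> (real, 'w) module \<Rightarrow> bool"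
    (infix \<open>\<cong>\<^sub>L\<close> 50) where
  "V \<cong>\<^sub>L W \<longleftrightarrow> (\<exists>h \<in> iso (add_monoid V) (add_monoid W).
     \<forall>t. \<forall>x \<in> carrier V. h (t \<odot>\<^bsub>V\<^esub> x) = t \<odot>\<^bsub>W\<^esub> h x)"

end

theory Submission
  imports Defs
begin

text \<open>
  Multiplication by \<open>e\<^sup>\<sigma>\<close> is an automorphism of the space of \<open>r\<close>-forms, and the Leibniz rule
  \<open>d(e\<^sup>\<sigma> \<phi>) = e\<^sup>\<sigma> (d\<phi> + d\<sigma> \<and> \<phi>)\<close> shows that it intertwines the two twisted differentials:
  \<open>d\<^bsub>f,\<theta>\<^esub> (e\<^sup>\<sigma> \<phi>) = e\<^sup>\<sigma> d\<^bsub>f,\<theta>-d\<sigma>\<^esub> \<phi>\<close>.  It therefore maps cocycles onto cocycles and coboundaries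
  onto coboundaries, and taking images of cosets is the required isomorphism.
\<close>

section \<open>Products and exponentials of smooth functions\<close>

text \<open>Functions agreeing near \<open>x\<close> have the same candidate derivatives at
  \<open>x\<close>, and \<open>frechet_derivative\<close> chooses from these candidates alone. Hence
  the values agree even where no derivative exists.\<close>

lemma frechet_derivative_cong_open:
  assumes "open S" "x \<in> S" "\<And>y. y \<in> S \<Longrightarrow> g y = h y"
  shows "frechet_derivative g (at x) = frechet_derivative h (at x)"
proof -
  have "(g has_derivative D) (at x) \<longleftrightarrow> (h has_derivative D) (at x)" for D
    using assms has_derivative_transform_within_open[of _ D x UNIV S] by metis
  then show ?thesis
    by (simp add: frechet_derivative_def)
qed

lemma differentiable_cong_open:
  assumes "open S" "x \<in> S" "\<And>y. y \<in> S \<Longrightarrow> g y = h y" "g differentiable (at x)"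
  shows "h differentiable (at x)"
  using assms has_derivative_transform_within_open[of g _ x UNIV S h]
  unfolding differentiable_def by metis

text \<open>Iterated derivatives see only a neighbourhood of each point, and the open set
  \<open>S\<close> contains one. This lets an explicit formula, valid only on \<open>S\<close>,
  replace a derivative in the inductions below.\<close>

lemma Ck_on_cong:
  assumes "open S" "\<And>y. y \<in> S \<Longrightarrow> g y = h y" "Ck_on k S g"
  shows "Ck_on k S h"
  using assms(2,3)
proof (induction k arbitrary: g h)
  case 0
  then show ?case
    by (metis Ck_on.simps(1) continuous_on_cong)
next
  case (Suc k)
  have "Ck_on k S (\<lambda>x. frechet_derivative h (at x) v)" for v
  proof (rule Suc.IH)
    show "frechet_derivative g (at y) v = frechet_derivative h (at y) v" if "y \<in> S" for y
      using frechet_derivative_cong_open[OF assms(1) that] Suc.prems(1) by metis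
    show "Ck_on k S (\<lambda>x. frechet_derivative g (at x) v)"
      using Suc.prems(2) by simp
  qed
  moreover have "h differentiable (at x)" if "x \<in> S" for x
    using differentiable_cong_open[OF assms(1) that] Suc.prems that by (metis Ck_on.simps(2))
  ultimately show ?case
    by simp
qed

text \<open>The successor clause of \<open>Ck_on\<close> does not mention continuity of
  \<open>g\<close> itself; at the bottom level it is recovered from differentiability.\<close>

lemma Ck_on_Suc_imp_Ck_on:
  assumes "Ck_on (Suc k) S g"
  shows "Ck_on k S g"
  using assms
proof (induction k arbitrary: g)
  case 0
  then show ?case
    by (auto intro!: continuous_at_imp_continuous_on differentiable_imp_continuous_within)
next
  case (Suc k)
  then show ?case
    by (metis Ck_on.simps(2))
qed

lemma frechet_derivative_add:
  assumes "g differentiable (at x)" "h differentiable (at x)"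
  shows "frechet_derivative (\<lambda>x. g x + h x) (at x) =
    (\<lambda>v. frechet_derivative g (at x) v + frechet_derivative h (at x) v)"
  using assms unfolding frechet_derivative_works
  by (intro frechet_derivative_at[symmetric] has_derivative_add)

lemma Ck_on_add:
  assumes "open S" "Ck_on k S g" "Ck_on k S h"
  shows "Ck_on k S (\<lambda>x. g x + h x)"
  using assms(2,3)
proof (induction k arbitrary: g h)
  case 0
  then show ?case
    by (simp add: continuous_on_add)
next
  case (Suc k)
  have "Ck_on k S (\<lambda>x. frechet_derivative (\<lambda>x. g x + h x) (at x) v)" for v
  proof (rule Ck_on_cong[OF assms(1)])
    show "Ck_on k S (\<lambda>x. frechet_derivative g (at x) v + frechet_derivative h (at x) v)"
      using Suc by simp
    show "frechet_derivative g (at y) v + frechet_derivative h (at y) v =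
        frechet_derivative (\<lambda>x. g x + h x) (at y) v" if "y \<in> S" for y
      using Suc.prems that by (simp add: frechet_derivative_add)
  qed
  with Suc.prems show ?case
    by simp
qed

lemma frechet_derivative_mult_real:
  fixes g h :: "'a::real_normed_vector \<Rightarrow> real"
  assumes "g differentiable (at x)" "h differentiable (at x)"
  shows "frechet_derivative (\<lambda>x. g x * h x) (at x) =
    (\<lambda>v. g x * frechet_derivative h (at x) v + frechet_derivative g (at x) v * h x)"
  using assms unfolding frechet_derivative_works
  by (intro frechet_derivative_at[symmetric] has_derivative_mult)

lemma Ck_on_mult:
  fixes g h :: "'a::real_normed_vector \<Rightarrow> real"
  assumes "open S" "Ck_on k S g" "Ck_on k S h"
  shows "Ck_on k S (\<lambda>x. g x * h x)"
  using assms(2,3)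
proof (induction k arbitrary: g h)
  case 0
  then show ?case
    by (simp add: continuous_on_mult)
next
  case (Suc k)
  have "Ck_on k S (\<lambda>x. frechet_derivative (\<lambda>x. g x * h x) (at x) v)" for v
  proof (rule Ck_on_cong[OF assms(1)])
    show "Ck_on k S (\<lambda>x. g x * frechet_derivative h (at x) v +
        frechet_derivative g (at x) v * h x)"
      \<comment> \<open>Each product in the Leibniz formula has one undifferentiated factor, of
        class \<open>Suc k\<close>, which is lowered to class \<open>k\<close> to fit the induction
        hypothesis.\<close>
      using Suc.prems Ck_on_Suc_imp_Ck_on[OF Suc.prems(1)] Ck_on_Suc_imp_Ck_on[OF Suc.prems(2)]
      by (intro Ck_on_add[OF assms(1)] Suc.IH) auto
    show "g y * frechet_derivative h (at y) v + frechet_derivative g (at y) v * h y =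
        frechet_derivative (\<lambda>x. g x * h x) (at y) v" if "y \<in> S" for y
      using Suc.prems that by (simp add: frechet_derivative_mult_real)
  qed
  with Suc.prems show ?case
    by simp
qed

lemma has_derivative_exp_comp:
  fixes g :: "'a::real_normed_vector \<Rightarrow> real"
  assumes "g differentiable (at x)"
  shows "((\<lambda>x. exp (g x)) has_derivative (\<lambda>v. exp (g x) * frechet_derivative g (at x) v)) (at x)"
proof -
  have "(g has_derivative frechet_derivative g (at x)) (at x)"
    using assms frechet_derivative_works by blast
  from has_derivative_exp[OF this] show ?thesis
    by (simp add: mult.commute)
qed

text \<open>The derivative of \<open>exp (g x)\<close> contains \<open>exp (g x)\<close> again, so
  induction on \<open>k\<close> with \<open>g\<close> fixed suffices: the exponential factor is
  \<open>k\<close> times differentiable by the induction hypothesis, the other factor by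
  assumption.\<close>

lemma Ck_on_exp:
  fixes g :: "'a::real_normed_vector \<Rightarrow> real"
  assumes "open S" "Ck_on k S g"
  shows "Ck_on k S (\<lambda>x. exp (g x))"
  using assms(2)
proof (induction k)
  case 0
  then show ?case
    by (simp add: continuous_on_exp)
next
  case (Suc k)
  note deriv = has_derivative_exp_comp
  have "Ck_on k S (\<lambda>x. frechet_derivative (\<lambda>x. exp (g x)) (at x) v)" for v
  proof (rule Ck_on_cong[OF assms(1)])
    show "Ck_on k S (\<lambda>x. exp (g x) * frechet_derivative g (at x) v)"
      using Suc.prems Suc.IH[OF Ck_on_Suc_imp_Ck_on[OF Suc.prems]]
      by (intro Ck_on_mult[OF assms(1)]) auto
    show "exp (g y) * frechet_derivative g (at y) v =
        frechet_derivative (\<lambda>x. exp (g x)) (at y) v" if "y \<in> S" for y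
      using frechet_derivative_at[OF deriv] Suc.prems that by (metis Ck_on.simps(2))
  qed
  moreover have "(\<lambda>x. exp (g x)) differentiable (at x)" if "x \<in> S" for x
    using deriv Suc.prems that unfolding differentiable_def[of "\<lambda>x. exp (g x)"]
    by (metis Ck_on.simps(2))
  ultimately show ?case
    by simp
qed

lemma smooth_on_mult:
  fixes g h :: "'a::real_normed_vector \<Rightarrow> real"
  shows "open S \<Longrightarrow> smooth_on S g \<Longrightarrow> smooth_on S h \<Longrightarrow> smooth_on S (\<lambda>x. g x * h x)"
  by (simp add: smooth_on_def Ck_on_mult)

lemma smooth_on_exp:
  fixes g :: "'a::real_normed_vector \<Rightarrow> real"
  shows "open S \<Longrightarrow> smooth_on S g \<Longrightarrow> smooth_on S (\<lambda>x. exp (g x))"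
  by (simp add: smooth_on_def Ck_on_exp)

lemma smooth_on_uminus:
  fixes g :: "'a::real_normed_vector \<Rightarrow> real"
  assumes "open S" "smooth_on S g"
  shows "smooth_on S (\<lambda>x. - g x)"
proof -
  \<comment> \<open>The derivative of a constant is the constant 0, hence the generalisation over
    \<open>c\<close>.\<close>
  have "Ck_on k S (\<lambda>x. c)" for k and c :: real
    by (induction k arbitrary: c) simp_all
  then have "Ck_on k S (\<lambda>x. (-1) * g x)" for k
    using assms by (intro Ck_on_mult) (auto simp: smooth_on_def)
  then show ?thesis
    by (simp add: smooth_on_def)
qed

lemma smooth_on_imp_differentiable:
  "smooth_on S g \<Longrightarrow> x \<in> S \<Longrightarrow> g differentiable (at x)"
  unfolding smooth_on_def by (metis Ck_on.simps(2))


section \<open>Wedge products with 1-forms\<close>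

lemma length_nths_Compl_singleton:
  assumes "i < length vs"
  shows "length (nths vs (- {i})) = length vs - 1"
proof -
  have "{j. j < length vs \<and> j \<in> - {i}} = {..<length vs} - {i}"
    by auto
  then show ?thesis
    using assms by (simp add: length_nths)
qed

lemma nths_singleton_set:
  "i < length vs \<Longrightarrow> nths vs {i} = [vs ! i]"
proof (induction vs arbitrary: i)
  case (Cons v vs)
  then show ?case
    by (cases i) (auto simp: nths_Cons)
qed simp

lemma wedge_one_form:
  assumes "\<And>ws. length ws \<noteq> 1 \<Longrightarrow> \<alpha> c p ws = 0"
  shows "(\<alpha> \<and>\<^sub>F \<beta>) c p vs =
    (\<Sum>i<length vs. (-1) ^ i * \<alpha> c p [vs ! i] * \<beta> c p (nths vs (- {i})))"
proof -
  let ?n = "length vs"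
  let ?t = "\<lambda>S. (- 1) ^ card {(i, j). i \<in> S \<and> j \<in> {..<?n} - S \<and> j < i} *
     \<alpha> c p (nths vs S) * \<beta> c p (nths vs (- S))"
  \<comment> \<open>The sublist at the positions \<open>S\<close> has length \<open>card S\<close>,
    so only singletons pass an admissible argument to \<open>\<alpha>\<close>.\<close>
  have "?t S = 0" if "S \<in> Pow {..<?n} - (\<lambda>i. {i}) ` {..<?n}" for S
  proof -
    have "{i. i < ?n \<and> i \<in> S} = S"
      using that by auto
    then have "length (nths vs S) = card S"
      by (simp add: length_nths)
    moreover have "card S \<noteq> 1"
      using that by (auto simp: card_1_singleton_iff)
    ultimately show ?thesis
      using assms by simp
  qed
  then have "(\<alpha> \<and>\<^sub>F \<beta>) c p vs = sum ?t ((\<lambda>i. {i}) ` {..<?n})"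
    unfolding wedge_def by (intro sum.mono_neutral_right) auto
  also have "\<dots> = (\<Sum>i<?n. ?t {i})"
    by (subst sum.reindex) (auto simp: inj_on_def)
  also have "\<dots> = (\<Sum>i<?n. (-1) ^ i * \<alpha> c p [vs ! i] * \<beta> c p (nths vs (- {i})))"
  proof (rule sum.cong[OF refl])
    fix i assume i: "i \<in> {..<?n}"
    \<comment> \<open>Moving position \<open>i\<close> to the front passes exactly the
      \<open>i\<close> earlier positions, which gives the sign.\<close>
    have "{(k, j). k \<in> {i} \<and> j \<in> {..<?n} - {i} \<and> j < k} = Pair i ` {..<i}"
      using i by auto
    then have "card {(k, j). k \<in> {i} \<and> j \<in> {..<?n} - {i} \<and> j < k} = i"
      by (simp add: card_image inj_on_def)
    then show "?t {i} = (-1) ^ i * \<alpha> c p [vs ! i] * \<beta> c p (nths vs (- {i}))"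
      using i nths_singleton_set[of i vs] by simp
  qed
  finally show ?thesis .
qed

lemma wedge_diff_left: "(\<alpha> - \<beta>) \<and>\<^sub>F \<phi> = \<alpha> \<and>\<^sub>F \<phi> - \<beta> \<and>\<^sub>F \<phi>"
  by (simp add: wedge_def fun_eq_iff left_diff_distrib right_diff_distrib sum_subtractf)

lemma wedge_fmult_left: "fmult g \<alpha> \<and>\<^sub>F \<phi> = fmult g (\<alpha> \<and>\<^sub>F \<phi>)"
  by (simp add: wedge_def fmult_def fun_eq_iff sum_distrib_left mult_ac)

lemma wedge_fmult_right: "\<alpha> \<and>\<^sub>F fmult g \<phi> = fmult g (\<alpha> \<and>\<^sub>F \<phi>)"
  by (simp add: wedge_def fmult_def fun_eq_iff sum_distrib_left mult_ac)

section \<open>Algebra of multiplying forms by functions\<close>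

lemma fmult_add: "fmult g (\<alpha> + \<beta>) = fmult g \<alpha> + fmult g \<beta>"
  by (simp add: fmult_def fun_eq_iff algebra_simps)

lemma fmult_zero: "fmult g 0 = 0"
  by (simp add: fmult_def fun_eq_iff)

lemma fmult_left_commute: "fmult g (fmult h \<phi>) = fmult h (fmult g \<phi>)"
  by (simp add: fmult_def fun_eq_iff)

lemma fmult_exp_cancel [simp]:
  "fmult (\<lambda>p. exp (\<sigma> p)) (fmult (\<lambda>p. exp (- \<sigma> p)) \<phi>) = \<phi>"
  "fmult (\<lambda>p. exp (- \<sigma> p)) (fmult (\<lambda>p. exp (\<sigma> p)) \<phi>) = \<phi>"
  by (simp_all add: fmult_def fun_eq_iff exp_minus)


section \<open>Isomorphisms of quotients\<close>

text \<open>The isomorphism sends a coset to its direct image under \<open>h\<close>. As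
  \<open>h\<close> is injective on the whole type of forms, taking images is injective on sets of
  forms.\<close>

lemma quotient_space_isomorphic:
  fixes h :: "('m, 'e) form \<Rightarrow> ('m, 'e) form"
  assumes inj: "inj h" and add: "\<And>x y. h (x + y) = h x + h y"
    and scale: "\<And>t x. h (fmult (\<lambda>_. t) x) = fmult (\<lambda>_. t) (h x)"
    and V: "h ` V = V'" and W: "h ` W = W'"
  shows "quotient_space (form_space V) W \<cong>\<^sub>L quotient_space (form_space V') W'"
proof -
  let ?Q = "quotient_space (form_space V) W" and ?Q' = "quotient_space (form_space V') W'"
  let ?coset = "\<lambda>U x. (\<lambda>w. w + x) ` U"
  have carrier: "carrier (quotient_space (form_space V) W) = ?coset W ` V"
    for V W :: "('m, 'e) form set"
    by (auto simp: quotient_space_def form_space_def A_RCOSETS_defs a_r_coset_def r_coset_def)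
  have plus: "add (quotient_space (form_space V) W) K L = (\<Union>x\<in>K. \<Union>y\<in>L. {x + y})"
    for V W K L :: "('m, 'e) form set"
    by (simp add: quotient_space_def form_space_def set_add_defs)
  have smult: "smult (quotient_space (form_space V) W) t K =
      (\<Union>x\<in>K. ?coset W (fmult (\<lambda>_. t) x))" for V W K :: "('m, 'e) form set" and t
    by (auto simp: quotient_space_def form_space_def a_r_coset_def r_coset_def)
  have coset: "h ` ?coset W x = ?coset W' (h x)" for x
    by (auto simp: W[symmetric] image_image add)
  have img: "(`) h ` carrier ?Q = carrier ?Q'"
    unfolding carrier V[symmetric] by (simp add: image_image coset[unfolded image_image])
  have "bij_betw ((`) h) (carrier ?Q) (carrier ?Q')"
    unfolding bij_betw_def using img inj by (auto simp: inj_on_def inj_image_eq_iff)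
  \<comment> \<open>Both quotient operations are unions over elements, and images commute with
    unions, so compatibility holds for arbitrary sets and not just for cosets.\<close>
  moreover have "h ` add ?Q K L = add ?Q' (h ` K) (h ` L)" for K L
    by (auto simp: plus image_UN add)
  moreover have "h ` smult ?Q t K = smult ?Q' t (h ` K)" for t K
    unfolding smult image_UN coset by (simp add: scale)
  ultimately have "(`) h \<in> iso (add_monoid ?Q) (add_monoid ?Q')"
    using img by (auto simp: iso_def hom_def)
  then show ?thesis
    unfolding linearly_isomorphic_def
    using \<open>\<And>t K. h ` smult ?Q t K = smult ?Q' t (h ` K)\<close> by blast
qed


section \<open>Multiplication by smooth functions\<close>

lemma formsD_outside:
  "\<phi> \<in> forms A r \<Longrightarrow> c \<notin> A \<or> p \<notin> chart_dom c \<or> length vs \<noteq> r \<Longrightarrow> \<phi> c p vs = 0"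
  unfolding forms_def by blast

lemma formsD_smooth:
  "\<phi> \<in> forms A r \<Longrightarrow> c \<in> A \<Longrightarrow> length vs = r \<Longrightarrow>
    smooth_on (chart_map c ` chart_dom c) (\<lambda>x. \<phi> c (chart_inv c x) vs)"
  unfolding forms_def by blast

text \<open>\<open>ext_deriv\<close> itself tests only \<open>p\<close>. For a chart outside the
  atlas, or for at least two vectors, the 0-form being differentiated is identically zero; for no
  vectors the sum is empty.\<close>

lemma differential_eq_0:
  assumes "c \<notin> A \<or> p \<notin> chart_dom c \<or> length vs \<noteq> 1"
  shows "differential A g c p vs = 0"
proof -
  have "frechet_derivative (\<lambda>x. fun_form A g c (chart_inv c x) (nths vs (- {i})))
      (at (chart_map c p)) w = 0" if "i < length vs" "c \<notin> A \<or> length vs \<noteq> 1" for i w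
  proof -
    have "nths vs (- {i}) \<noteq> [] \<or> c \<notin> A"
      using length_nths_Compl_singleton[OF that(1)] that by auto
    then have "(\<lambda>x. fun_form A g c (chart_inv c x) (nths vs (- {i}))) = (\<lambda>x. 0)"
      by (auto simp: fun_form_def)
    then show ?thesis
      by simp
  qed
  with assms show ?thesis
    by (auto simp: ext_deriv_def)
qed

context smooth_manifold
begin

section \<open>Charts, and forms as a module over the smooth functions\<close>

lemma open_chart_image: "c \<in> A \<Longrightarrow> open (chart_map c ` chart_dom c)"
  using charts by (auto simp: is_chart_def)

lemma inj_on_chart_map:
  assumes "c \<in> A"
  shows "inj_on (chart_map c) (chart_dom c)"
proof -
  have "topspace (subtopology X (chart_dom c)) = chart_dom c"
    using charts[OF assms] openin_subset by (fastforce simp: is_chart_def)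
  with charts[OF assms] show ?thesis
    by (metis is_chart_def homeomorphic_imp_injective_map)
qed

lemma chart_inv_chart_map [simp]:
  "c \<in> A \<Longrightarrow> p \<in> chart_dom c \<Longrightarrow> chart_inv c (chart_map c p) = p"
  by (simp add: chart_inv_def inj_on_chart_map)

lemma exp_smooth_funs:
  "\<sigma> \<in> smooth_funs A \<Longrightarrow> (\<lambda>p. exp (\<sigma> p)) \<in> smooth_funs A"
  by (auto simp: smooth_funs_def o_def intro!: smooth_on_exp open_chart_image)

lemma uminus_smooth_funs:
  "\<sigma> \<in> smooth_funs A \<Longrightarrow> (\<lambda>p. - \<sigma> p) \<in> smooth_funs A"
  by (auto simp: smooth_funs_def o_def intro!: smooth_on_uminus open_chart_image)

lemma fmult_forms:
  assumes g: "g \<in> smooth_funs A" and \<phi>: "\<phi> \<in> forms A r"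
  shows "fmult g \<phi> \<in> forms A r"
proof -
  have linear: "linear (\<lambda>v. g p * \<phi> c p (vs[i := v]))"
    if "c \<in> A" "p \<in> chart_dom c" "length vs = r" "i < r" for c p vs i
  proof -
    have "linear (\<lambda>v. \<phi> c p (vs[i := v]))"
      using \<phi> that unfolding forms_def by blast
    then show ?thesis
      by (simp add: linear_iff algebra_simps)
  qed
  have alternating: "g p * \<phi> c p vs = 0"
    if "c \<in> A" "p \<in> chart_dom c" "length vs = r" "\<not> distinct vs" for c p vs
  proof -
    have "\<phi> c p vs = 0"
      using \<phi> that unfolding forms_def by blast
    then show ?thesis
      by simp
  qed
  \<comment> \<open>The factor \<open>g p\<close> depends on the point and not on the chart, so it
    is the same on both sides.\<close>
  have compatible: "g p * \<phi> c p vs =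
      g p * \<phi> c' p (map (frechet_derivative (transition c c') (at (chart_map c p))) vs)"
    if "c \<in> A" "c' \<in> A" "p \<in> chart_dom c \<inter> chart_dom c'" "length vs = r" for c c' p vs
  proof -
    have "\<phi> c p vs =
        \<phi> c' p (map (frechet_derivative (transition c c') (at (chart_map c p))) vs)"
      using \<phi> that unfolding forms_def by blast
    then show ?thesis
      by (rule arg_cong)
  qed
  have smooth: "smooth_on (chart_map c ` chart_dom c)
      (\<lambda>x. g (chart_inv c x) * \<phi> c (chart_inv c x) vs)"
    if "c \<in> A" "length vs = r" for c vs
    using g that formsD_smooth[OF \<phi> that]
    by (intro smooth_on_mult open_chart_image) (auto simp: smooth_funs_def o_def)
  have outside: "g p * \<phi> c p vs = 0" if "c \<notin> A \<or> p \<notin> chart_dom c \<or> length vs \<noteq> r" for c p vs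
    using formsD_outside[OF \<phi> that] by simp
  show ?thesis
    unfolding forms_def fmult_def mem_Collect_eq
    by (intro conjI allI impI ballI)
      ((rule outside linear alternating compatible smooth; assumption)+)
qed

section \<open>Differentials and the Leibniz rule\<close>

lemma differential_singleton:
  assumes "c \<in> A" "p \<in> chart_dom c"
  shows "differential A g c p [v] =
    frechet_derivative (\<lambda>x. g (chart_inv c x)) (at (chart_map c p)) v"
proof -
  \<comment> \<open>The two functions are known to agree only on the chart image, where
    \<open>chart_inv c\<close> lands in the chart domain; openness of the image is enough.\<close>
  have "frechet_derivative (\<lambda>x. fun_form A g c (chart_inv c x) []) (at (chart_map c p)) =
      frechet_derivative (\<lambda>x. g (chart_inv c x)) (at (chart_map c p))"
    using assms
    by (intro frechet_derivative_cong_open[OF open_chart_image]) (auto simp: fun_form_def)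
  then show ?thesis
    using assms by (simp add: ext_deriv_def nths_Cons)
qed

lemma differential_exp:
  assumes "\<sigma> \<in> smooth_funs A"
  shows "differential A (\<lambda>p. exp (\<sigma> p)) = fmult (\<lambda>p. exp (\<sigma> p)) (differential A \<sigma>)"
proof (intro ext)
  fix c p and vs :: "'e list"
  show "differential A (\<lambda>p. exp (\<sigma> p)) c p vs =
      fmult (\<lambda>p. exp (\<sigma> p)) (differential A \<sigma>) c p vs"
  proof (cases "c \<in> A \<and> p \<in> chart_dom c \<and> length vs = 1")
    case True
    then obtain v where "vs = [v]"
      by (auto simp: length_Suc_conv)
    have "(\<lambda>x. \<sigma> (chart_inv c x)) differentiable (at (chart_map c p))"
      using assms True
      by (intro smooth_on_imp_differentiable[of "chart_map c ` chart_dom c"])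
        (auto simp: smooth_funs_def o_def)
    from frechet_derivative_at[OF has_derivative_exp_comp[OF this], symmetric]
    show ?thesis
      using True \<open>vs = [v]\<close> by (simp add: differential_singleton fmult_def)
  next
    case False
    then show ?thesis
      by (simp add: differential_eq_0 fmult_def)
  qed
qed

text \<open>In a chart, the product rule is applied to each summand of \<open>ext_deriv\<close>. The
  terms differentiating \<open>g\<close> form precisely the alternating sum of
  \<open>wedge_one_form\<close>.\<close>

lemma ext_deriv_fmult:
  assumes g: "g \<in> smooth_funs A" and \<phi>: "\<phi> \<in> forms A r"
  shows "ext_deriv (fmult g \<phi>) = fmult g (ext_deriv \<phi>) + differential A g \<and>\<^sub>F \<phi>"
proof (intro ext)
  fix c p and vs :: "'e list"
  have wedge: "(differential A g \<and>\<^sub>F \<phi>) c p vs =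
    (\<Sum>i<length vs. (-1) ^ i * differential A g c p [vs ! i] * \<phi> c p (nths vs (- {i})))"
    by (rule wedge_one_form) (simp add: differential_eq_0)
  consider "p \<notin> chart_dom c" | "p \<in> chart_dom c" "c \<notin> A \<or> length vs \<noteq> Suc r"
    | "c \<in> A" "p \<in> chart_dom c" "length vs = Suc r"
    by blast
  then show "ext_deriv (fmult g \<phi>) c p vs =
      (fmult g (ext_deriv \<phi>) + differential A g \<and>\<^sub>F \<phi>) c p vs"
  proof cases
    case 1
    then show ?thesis
      by (simp add: wedge differential_eq_0) (simp add: ext_deriv_def fmult_def)
  next
    case 2
    \<comment> \<open>Omitting one vector leaves a list of length other than \<open>r\<close>, or
      the chart is not in the atlas; either way every summand on both sides vanishes.\<close>
    have "\<phi> c q (nths vs (- {i})) = 0" if "i < length vs" for q i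
      using 2 that by (intro formsD_outside[OF \<phi>]) (auto simp: length_nths_Compl_singleton)
    then show ?thesis
      by (simp add: wedge) (simp add: ext_deriv_def fmult_def)
  next
    case 3
    let ?x = "chart_map c p"
    let ?\<phi> = "\<lambda>i x. \<phi> c (chart_inv c x) (nths vs (- {i}))"
    have x: "?x \<in> chart_map c ` chart_dom c"
      using 3 by simp
    have "frechet_derivative (\<lambda>x. g (chart_inv c x) * ?\<phi> i x) (at ?x) (vs ! i) =
        g p * frechet_derivative (?\<phi> i) (at ?x) (vs ! i) +
        differential A g c p [vs ! i] * \<phi> c p (nths vs (- {i}))" if "i < length vs" for i
    proof -
      have "(\<lambda>x. g (chart_inv c x)) differentiable (at ?x)"
        using g 3 x by (intro smooth_on_imp_differentiable[of "chart_map c ` chart_dom c"])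
          (auto simp: smooth_funs_def o_def)
      moreover have "?\<phi> i differentiable (at ?x)"
        using smooth_on_imp_differentiable[OF formsD_smooth[OF \<phi>] x] 3
          length_nths_Compl_singleton[OF that] by simp
      ultimately show ?thesis
        using 3 by (simp add: frechet_derivative_mult_real differential_singleton)
    qed
    then have "ext_deriv (fmult g \<phi>) c p vs =
        (\<Sum>i<length vs. (-1) ^ i * (g p * frechet_derivative (?\<phi> i) (at ?x) (vs ! i) +
          differential A g c p [vs ! i] * \<phi> c p (nths vs (- {i}))))"
      using 3 by (simp add: ext_deriv_def fmult_def)
    also have "\<dots> = g p * ext_deriv \<phi> c p vs + (differential A g \<and>\<^sub>F \<phi>) c p vs"
      using 3 unfolding wedge
      by (simp add: ext_deriv_def[of \<phi>] sum_distrib_left sum.distrib algebra_simps)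
    finally show ?thesis
      by (simp add: fmult_def)
  qed
qed

text \<open>Only the term \<open>f d\<phi>\<close> fails to be linear over functions. Its Leibniz
  surplus \<open>f d\<sigma> \<and> \<phi>\<close>, times the exponential, is exactly what replacing
  \<theta> by \<theta> - d\<sigma> adds to \<open>- f \<theta> \<and> \<phi>\<close>. The
  \<open>df\<close> term keeps its coefficient because the degree is unchanged.\<close>

lemma d_f_theta_exp:
  assumes "\<sigma> \<in> smooth_funs A" "\<phi> \<in> forms A r"
  shows "d_f_theta A f \<theta> r (fmult (\<lambda>p. exp (\<sigma> p)) \<phi>) =
    fmult (\<lambda>p. exp (\<sigma> p)) (d_f_theta A f (\<theta> - differential A \<sigma>) r \<phi>)"
  unfolding d_f_theta_def d_f_def ext_deriv_fmult[OF exp_smooth_funs[OF assms(1)] assms(2)]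
    differential_exp[OF assms(1)] wedge_fmult_left wedge_fmult_right wedge_diff_left
  by (simp add: fmult_def fun_eq_iff algebra_simps)

section \<open>Images of forms, cocycles and coboundaries under multiplication by the
  exponential\<close>

lemma fmult_exp_image_forms:
  assumes "\<sigma> \<in> smooth_funs A"
  shows "fmult (\<lambda>p. exp (\<sigma> p)) ` forms A r = forms A r"
proof
  show "fmult (\<lambda>p. exp (\<sigma> p)) ` forms A r \<subseteq> forms A r"
    using assms exp_smooth_funs fmult_forms by blast
  show "forms A r \<subseteq> fmult (\<lambda>p. exp (\<sigma> p)) ` forms A r"
  proof
    fix \<phi> assume "\<phi> \<in> forms A r"
    \<comment> \<open>This is the preimage of \<open>\<phi>\<close>; it is a form because
      \<open>- \<sigma>\<close> is smooth too.\<close>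
    then have "fmult (\<lambda>p. exp (- \<sigma> p)) \<phi> \<in> forms A r"
      by (intro fmult_forms exp_smooth_funs uminus_smooth_funs assms)
    then show "\<phi> \<in> fmult (\<lambda>p. exp (\<sigma> p)) ` forms A r"
      by (metis fmult_exp_cancel(1) imageI)
  qed
qed

lemma fmult_exp_image_cocycles:
  assumes "\<sigma> \<in> smooth_funs A"
  shows "fmult (\<lambda>p. exp (\<sigma> p)) ` cocycles A f (\<theta> - differential A \<sigma>) r = cocycles A f \<theta> r"
    (is "?e ` _ = _")
proof -
  \<comment> \<open>By the intertwining relation the left side says that the exponential times the
    other differential is 0; multiplying by \<open>exp (- \<sigma> p)\<close> removes the
    factor.\<close>
  have "d_f_theta A f \<theta> r (?e \<phi>) = 0 \<longleftrightarrow> d_f_theta A f (\<theta> - differential A \<sigma>) r \<phi> = 0"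
    if "\<phi> \<in> forms A r" for \<phi>
    by (metis d_f_theta_exp[OF assms that] fmult_exp_cancel(2) fmult_zero)
  then have "?e ` cocycles A f (\<theta> - differential A \<sigma>) r =
      {\<phi> \<in> ?e ` forms A r. d_f_theta A f \<theta> r \<phi> = 0}"
    by (auto simp: cocycles_def)
  then show ?thesis
    by (simp add: fmult_exp_image_forms[OF assms] cocycles_def)
qed

lemma fmult_exp_image_coboundaries:
  assumes "\<sigma> \<in> smooth_funs A"
  shows "fmult (\<lambda>p. exp (\<sigma> p)) ` coboundaries A f (\<theta> - differential A \<sigma>) r =
    coboundaries A f \<theta> r" (is "?e ` _ = _")
proof (cases r)
  case 0
  then show ?thesis
    by (simp add: fmult_zero)
next
  case (Suc s)
  \<comment> \<open>Coboundaries of degree \<open>Suc s\<close> come from forms of degree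
    \<open>s\<close>, so the intertwining relation is used with coefficient
    \<open>s\<close>.\<close>
  have "?e ` coboundaries A f (\<theta> - differential A \<sigma>) r =
      (\<lambda>\<phi>. d_f_theta A f \<theta> s (?e \<phi>)) ` forms A s"
    using Suc d_f_theta_exp[OF assms] by (simp add: image_image)
  also have "\<dots> = d_f_theta A f \<theta> s ` ?e ` forms A s"
    by (simp add: image_image)
  finally show ?thesis
    using Suc by (simp add: fmult_exp_image_forms[OF assms])
qed

end

theorem proposition3p3:
  fixes X :: "'m topology"
    and A :: "('m, 'e::real_normed_vector) chart set"
    and f :: "'m \<Rightarrow> real"
    and \<theta> :: "('m, 'e) form"
  assumes "smooth_manifold X A"
    and "f \<in> smooth_funs A"
    and "closed_one_form A \<theta>"
  shows "\<forall>\<sigma> \<in> smooth_funs A. \<forall>r::nat.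
    cohomology A f (\<theta> - differential A \<sigma>) r \<cong>\<^sub>L cohomology A f \<theta> r"
proof (intro ballI allI)
  fix \<sigma> r assume \<sigma>: "\<sigma> \<in> smooth_funs A"
  interpret smooth_manifold X A
    by fact
  show "cohomology A f (\<theta> - differential A \<sigma>) r \<cong>\<^sub>L cohomology A f \<theta> r"
    unfolding cohomology_def
  \<comment> \<open>The map \<open>h\<close> is multiplication by \<open>exp (\<sigma> p)\<close>,
    from the complex of \<theta> - d\<sigma> to that of \<theta>. Its homogeneity is the commutation
    of this factor with constant functions.\<close>
  proof (rule quotient_space_isomorphic)
    show "inj (fmult (\<lambda>p. exp (\<sigma> p)) :: ('m, 'e) form \<Rightarrow> _)"
      by (metis fmult_exp_cancel(2) injI)
  qed (use \<sigma> in \<open>simp_all add: fmult_add fmult_left_commute[of "\<lambda>p. exp (\<sigma> p)"]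
      fmult_exp_image_cocycles fmult_exp_image_coboundaries\<close>)
qed

end
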